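(* Let $r\ge2$, $n=2^r$. (1) All zeroed diamond codes of length $n+1$ have the same weight distribution, and all non-zeroed diamond codes of length $n+1$ have the same weight distribution. (2) All zeroed ENP1CCs of length $n+1$ have the same weight distribution. The non-zeroed ENP1CCs of length $n+1$ have exactly three possible weight distributions: one for which $A_0=0$, $A_1=1$, $A_2=0$; one for which $A_0=0$, $A_1=2$, $A_2=0$; and one for which $A_0=0$, $A_1=0$, $A_2=\frac{n}{2}+1$.
   Context: All codes are binary; for a code $\mathcal{C}$ of length $m$, its weight distribution is $(A_0,\dots,A_m)$ with $A_i$ the number of codewords of Hamming weight $i$. A code is zeroed if it contains the all-zero word and non-zeroed otherwise. An NP1CC of length $n=2^r$ is a code $\mathcal{C}\subseteq\mathbb{F}_2^n$ with $|\mathcal{C}|=2^{n-r}$ such that every word of $\mathbb{F}_2^n$ is at distance at most $1$ from some codeword. An ENP1CC is a code of length $n+1$ of the form $\{(\mathbf{c},p(\mathbf{c})):\mathbf{c}\in\mathcal{C}\}$ or $\{(\mathbf{c},1+p(\mathbf{c})):\mathbf{c}\in\mathcal{C}\}$ for an NP1CC $\mathcal{C}$, where $p(\mathbf{c})=\sum_i c_i\bmod 2$. A diamond code of length $m$ is a code $\hat{\mathcal{C}}\subseteq\mathbb{F}_2^m$, nonempty with nonempty complement, such that every codeword has exactly $2$ codewords at distance $1$ and every non-codeword has exactly $1$ codeword at distance $1$. *)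

theory Defs
  imports Main "HOL-Library.Z2"
begin

type_synonym word = "bit list"

definition words :: "nat \<Rightarrow> word set" where
  "words m = {x. length x = m}"

(* Only meaningful for words of equal length. *)
definition hamming_dist :: "word \<Rightarrow> word \<Rightarrow> nat" where
  "hamming_dist x y = card {i. i < length x \<and> x ! i \<noteq> y ! i}"

definition hamming_weight :: "word \<Rightarrow> nat" where
  "hamming_weight x = card {i. i < length x \<and> x ! i \<noteq> 0}"

(* The tuple (A_0, ..., A_m) of a code of length m is given as a function on all of nat;
   it vanishes beyond m, so equality of functions is equality of tuples. *)
definition weight_distribution :: "word set \<Rightarrow> nat \<Rightarrow> nat" where
  "weight_distribution C i = card {c \<in> C. hamming_weight c = i}"

definition zeroed :: "nat \<Rightarrow> word set \<Rightarrow> bool" where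
  "zeroed m C \<longleftrightarrow> replicate m 0 \<in> C"

(* Nearly perfect 1-covering codes of length 2 ^ r. *)
definition np1cc :: "nat \<Rightarrow> word set \<Rightarrow> bool" where
  "np1cc r C \<longleftrightarrow> C \<subseteq> words (2 ^ r) \<and> card C = 2 ^ (2 ^ r - r) \<and>
     (\<forall>x \<in> words (2 ^ r). \<exists>c \<in> C. hamming_dist x c \<le> 1)"

definition parity :: "word \<Rightarrow> bit" where
  "parity c = (\<Sum>i<length c. c ! i)"

(* Extended nearly perfect 1-covering codes, of length 2 ^ r + 1. *)
definition enp1cc :: "nat \<Rightarrow> word set \<Rightarrow> bool" where
  "enp1cc r E \<longleftrightarrow> (\<exists>C. np1cc r C \<and>
     (E = {c @ [parity c] | c. c \<in> C} \<or> E = {c @ [1 + parity c] | c. c \<in> C}))"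

definition diamond_code :: "nat \<Rightarrow> word set \<Rightarrow> bool" where
  "diamond_code m C \<longleftrightarrow> C \<subseteq> words m \<and> C \<noteq> {} \<and> words m - C \<noteq> {} \<and>
     (\<forall>x \<in> C. card {c \<in> C. hamming_dist x c = 1} = 2) \<and>
     (\<forall>x \<in> words m - C. card {c \<in> C. hamming_dist x c = 1} = 1)"

end

theory Submission
  imports Defs
begin

text \<open>
  Let \<open>N\<close> be the adjacency operator of the hypercube, \<open>A = N + 1\<close>, and \<open>n = 2 ^ r\<close>.
  The indicator \<open>d\<close> of a diamond code satisfies \<open>N d = 1 + d\<close>; summing over the words of
  weight \<open>i\<close> gives a three-term recurrence for the weight distribution, which is therefore
  determined by whether the code is zeroed.

  If \<open>f\<close> is the indicator of an NP1CC, put \<open>A f = 1 + g\<close>, so that \<open>g \<ge> 0\<close> is integer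
  valued with sum \<open>|C|\<close>. As \<open>n\<close> is even, \<open>A g\<close> is odd outside \<open>C\<close>, hence at least \<open>1\<close> there,
  and a double count bounds the sum of \<open>g\<^sup>2\<close> by \<open>|C|\<close>; thus \<open>g\<close> is the indicator of a set \<open>E\<close>.
  The eigenvalues of \<open>A\<close> are odd, so \<open>A\<close> does not shrink norms, and it preserves the norm
  of \<open>n f - 1\<close>. Hence \<open>A\<^sup>2\<close> fixes \<open>n f - 1\<close>, which means \<open>A g = 1 + f\<close>. Extending \<open>C\<close> by
  one parity and \<open>E\<close> by the other therefore gives a diamond code of which the ENP1CC is the even
  or the odd part.
\<close>

section \<open>Binary words, neighbour sums and parity\<close>

lemma bit_cases: obtains "a = (0::bit)" | "a = 1"
  by (cases a) auto

lemma mem_words: "x \<in> words n \<longleftrightarrow> length x = n"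
  by (simp add: words_def)

lemma words_0: "words 0 = {[]}"
  by (auto simp: words_def)

lemma words_Suc: "words (Suc n) = Cons 0 ` words n \<union> Cons 1 ` words n"
proof -
  have "x \<in> Cons 0 ` words n \<union> Cons 1 ` words n" if "x \<in> words (Suc n)" for x
    using that by (cases x; cases "hd x") (auto simp: words_def)
  then show ?thesis by (auto simp: words_def)
qed

lemma finite_words: "finite (words n)"
  by (induction n) (auto simp: words_0 words_Suc)

lemma sum_words_Suc:
  "(\<Sum>x\<in>words (Suc n). F x) = (\<Sum>x\<in>words n. F (0 # x) + (F (1 # x) :: 'a :: comm_monoid_add))"
proof -
  have "(\<Sum>x\<in>words (Suc n). F x) = sum F (Cons 0 ` words n) + sum F (Cons 1 ` words n)"
    unfolding words_Suc by (rule sum.union_disjoint) (auto simp: finite_words)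
  also have "\<dots> = (\<Sum>x\<in>words n. F (0 # x)) + (\<Sum>x\<in>words n. F (1 # x))"
    by (simp add: sum.reindex)
  finally show ?thesis by (simp add: sum.distrib)
qed

lemma card_words: "card (words n) = 2 ^ n"
proof -
  have UNIV: "(UNIV :: bit set) = {0, 1}" using bit.exhaust by auto
  have "card {xs. set xs \<subseteq> (UNIV :: bit set) \<and> length xs = n} = card (UNIV :: bit set) ^ n"
    by (rule card_lists_length_eq) (simp add: UNIV)
  moreover have "card (UNIV :: bit set) = 2" by (simp add: UNIV)
  ultimately show ?thesis by (simp add: words_def)
qed

text \<open>\<open>nbsum F x\<close> is the sum of \<open>F\<close> over the words at distance 1 from \<open>x\<close>, see \<open>nbsum_eq_sum\<close>.\<close>

primrec nbsum :: "(word \<Rightarrow> int) \<Rightarrow> word \<Rightarrow> int" where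
  "nbsum F [] = 0"
| "nbsum F (a # x) = F ((1 + a) # x) + nbsum (\<lambda>y. F (a # y)) x"

lemma nbsum_add: "nbsum (\<lambda>y. F y + G y) x = nbsum F x + nbsum G x"
  by (induction x arbitrary: F G) auto

lemma nbsum_diff: "nbsum (\<lambda>y. F y - G y) x = nbsum F x - nbsum G x"
  by (induction x arbitrary: F G) auto

lemma nbsum_scale: "nbsum (\<lambda>y. t * F y) x = t * nbsum F x"
  by (induction x arbitrary: F) (auto simp: algebra_simps)

lemma nbsum_const: "nbsum (\<lambda>y. t) x = int (length x) * t"
  by (induction x) (auto simp: algebra_simps)

lemma nbsum_append:
  "nbsum F (x @ [b]) = nbsum (\<lambda>y. F (y @ [b])) x + F (x @ [1 + b])"
  by (induction x arbitrary: F) auto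

lemma nbsum_nonneg: "(\<And>y. 0 \<le> F y) \<Longrightarrow> 0 \<le> nbsum F x"
  by (induction x arbitrary: F) auto

lemma parity_Nil: "parity [] = 0"
  by (simp add: parity_def)

lemma parity_Cons: "parity (a # x) = a + parity x"
  unfolding parity_def by (simp del: sum.lessThan_Suc add: sum.lessThan_Suc_shift)

lemma parity_append: "parity (x @ [b]) = parity x + b"
  by (induction x) (auto simp: parity_Nil parity_Cons ac_simps)

text \<open>Flipping one coordinate flips the parity, so only words of the opposite parity
  contribute. In \<open>diamond_join\<close> this makes all neighbours of a word fall into the same
  case.\<close>

lemma nbsum_cong_parity:
  assumes "\<And>y. length y = length x \<Longrightarrow> parity y = 1 + parity x \<Longrightarrow> F y = G y"
  shows "nbsum F x = nbsum G x"
  using assms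
proof (induction x arbitrary: F G)
  case (Cons a x)
  have "F ((1 + a) # x) = G ((1 + a) # x)"
    by (rule Cons.prems) (auto simp: parity_Cons ac_simps)
  moreover have "nbsum (\<lambda>y. F (a # y)) x = nbsum (\<lambda>y. G (a # y)) x"
    by (rule Cons.IH) (rule Cons.prems, auto simp: parity_Cons ac_simps)
  ultimately show ?case by simp
qed simp

lemma nbsum_cong:
  assumes "\<And>y. length y = length x \<Longrightarrow> F y = G y"
  shows "nbsum F x = nbsum G x"
  by (rule nbsum_cong_parity) (rule assms)

text \<open>The adjacency operator is self-adjoint; the induction splits off the first coordinate.
  Neighbour sums can thus be moved onto a test function.\<close>

lemma nbsum_symmetric:
  "(\<Sum>x\<in>words n. F x * nbsum G x) = (\<Sum>x\<in>words n. nbsum F x * G x)"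
proof (induction n arbitrary: F G)
  case (Suc n)
  have "(\<Sum>x\<in>words (Suc n). F x * nbsum G x) =
    (\<Sum>x\<in>words n. F (0 # x) * nbsum (\<lambda>x. G (0 # x)) x) +
    (\<Sum>x\<in>words n. F (1 # x) * nbsum (\<lambda>x. G (1 # x)) x) +
    (\<Sum>x\<in>words n. F (0 # x) * G (1 # x) + F (1 # x) * G (0 # x))"
    unfolding sum_words_Suc sum.distrib[symmetric] by (rule sum.cong) (auto simp: distrib_left)
  also have "\<dots> = (\<Sum>x\<in>words (Suc n). nbsum F x * G x)"
    unfolding sum_words_Suc sum.distrib[symmetric] Suc
    unfolding sum.distrib[symmetric] by (rule sum.cong) (auto simp: distrib_right)
  finally show ?case .
qed (simp add: words_0)

lemma sum_nbsum: "(\<Sum>x\<in>words n. nbsum F x) = int n * (\<Sum>x\<in>words n. F x)"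
proof -
  have "(\<Sum>x\<in>words n. 1 * nbsum F x) = (\<Sum>x\<in>words n. nbsum (\<lambda>_. 1) x * F x)"
    by (rule nbsum_symmetric)
  also have "\<dots> = (\<Sum>x\<in>words n. int n * F x)"
    by (rule sum.cong) (auto simp: nbsum_const words_def)
  finally show ?thesis by (simp add: sum_distrib_left)
qed

text \<open>Of the walks of two steps from \<open>x\<close>, \<open>length x\<close> return to
  \<open>x\<close>; every other endpoint differs from \<open>x\<close> in two coordinates and is
  reached twice, once for each order of the flips.\<close>

lemma even_nbsum_nbsum: "even (nbsum (nbsum F) x - int (length x) * F x)"
proof (induction x arbitrary: F)
  case (Cons a x)
  have "nbsum (nbsum F) (a # x) - int (length (a # x)) * F (a # x) =
    2 * nbsum (\<lambda>y. F ((1 + a) # y)) x +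
    (nbsum (nbsum (\<lambda>y. F (a # y))) x - int (length x) * F (a # x))"
    
    using nbsum_add[of "\<lambda>y. F ((1 + a) # y)" "nbsum (\<lambda>y. F (a # y))" x]
    by (simp add: distrib_right flip: add.assoc)
  then show ?case using Cons[of "\<lambda>y. F (a # y)"] by presburger
qed simp

section \<open>Indicators, Hamming distance and Hamming weight\<close>

abbreviation ind :: "'a set \<Rightarrow> 'a \<Rightarrow> int" where
  "ind C x \<equiv> of_bool (x \<in> C)"

lemma hamming_dist_Cons:
  "hamming_dist (a # x) (b # y) = of_bool (a \<noteq> b) + hamming_dist x y"
proof -
  have "{i. i < length (a # x) \<and> (a # x) ! i \<noteq> (b # y) ! i} =
    (if a \<noteq> b then {0} else {}) \<union> Suc ` {i. i < length x \<and> x ! i \<noteq> y ! i}"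
    by (auto simp: image_iff less_Suc_eq_0_disj split: if_splits)
  then show ?thesis
    unfolding hamming_dist_def by (simp add: card_insert_if card_image image_iff)
qed

lemma hamming_weight_Cons:
  "hamming_weight (a # x) = of_bool (a \<noteq> 0) + hamming_weight x"
proof -
  have "{i. i < length (a # x) \<and> (a # x) ! i \<noteq> 0} =
    (if a \<noteq> 0 then {0} else {}) \<union> Suc ` {i. i < length x \<and> x ! i \<noteq> 0}"
    by (auto simp: image_iff less_Suc_eq_0_disj split: if_splits)
  then show ?thesis
    unfolding hamming_weight_def by (simp add: card_insert_if card_image image_iff)
qed

lemma hamming_weight_Nil: "hamming_weight [] = 0"
  by (simp add: hamming_weight_def)

lemma hamming_weight_eq_0_iff: "hamming_weight x = 0 \<longleftrightarrow> x = replicate (length x) 0"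
  by (induction x) (auto simp: hamming_weight_Nil hamming_weight_Cons)

lemma parity_eq_weight: "parity x = of_nat (hamming_weight x)"
proof (induction x)
  case (Cons a x)
  then show ?case by (cases a) (auto simp: parity_Cons hamming_weight_Cons)
qed (simp add: parity_Nil hamming_weight_Nil)

lemma hamming_dist_eq_0_iff:
  "length x = length y \<Longrightarrow> hamming_dist x y = 0 \<longleftrightarrow> x = y"
  by (induction x y rule: list_induct2) (auto simp: hamming_dist_Cons hamming_dist_def)

lemma nbsum_eq_sum:
  "nbsum F x = (\<Sum>c\<in>words (length x). of_bool (hamming_dist x c = 1) * F c)"
proof (induction x arbitrary: F)
  case Nil
  then show ?case by (simp add: words_0 hamming_dist_def)
next
  case (Cons a x)
  have "(\<Sum>c\<in>words (length (a # x)). of_bool (hamming_dist (a # x) c = 1) * F c) =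
    (\<Sum>c\<in>words (length x). of_bool (hamming_dist x c = 1) * F (a # c)) +
    (\<Sum>c\<in>words (length x). of_bool (hamming_dist x c = 0) * F ((1 + a) # c))"
    by (cases a) (auto simp: sum_words_Suc hamming_dist_Cons sum.distrib)
  also have "(\<Sum>c\<in>words (length x). of_bool (hamming_dist x c = 0) * F ((1 + a) # c)) =
    (\<Sum>c\<in>words (length x). if x = c then F ((1 + a) # c) else 0)"
    by (rule sum.cong) (auto simp: words_def hamming_dist_eq_0_iff)
  also have "\<dots> = F ((1 + a) # x)"
    by (simp add: mem_words sum.delta'[OF finite_words])
  finally show ?case using Cons by simp
qed

lemma sum_ind:
  "C \<subseteq> words n \<Longrightarrow> (\<Sum>c\<in>words n. of_bool (P c) * ind C c) = int (card {c \<in> C. P c})"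
proof -
  assume "C \<subseteq> words n"
  then have "{c \<in> words n. P c \<and> c \<in> C} = {c \<in> C. P c}" by auto
  moreover have "(\<Sum>c\<in>words n. of_bool (P c) * ind C c) =
      (\<Sum>c\<in>words n. of_bool (P c \<and> c \<in> C))"
    by (rule sum.cong) auto
  moreover have "(\<Sum>c\<in>words n. of_bool (P c \<and> c \<in> C)) =
      int (card (words n \<inter> {c. P c \<and> c \<in> C}))"
    by (simp add: finite_words del: of_bool_conj)
  moreover have "words n \<inter> {c. P c \<and> c \<in> C} = {c \<in> words n. P c \<and> c \<in> C}" by auto
  ultimately show ?thesis by argo
qed

lemma nbsum_ind:
  "C \<subseteq> words (length x) \<Longrightarrow> nbsum (ind C) x = int (card {c \<in> C. hamming_dist x c = 1})"
  by (simp add: nbsum_eq_sum sum_ind)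

section \<open>Spectral gap of the hypercube\<close>

text \<open>The case \<open>t = 1\<close> sums over the ball of radius 1. Other shifts arise when
  coordinates are split off by induction.\<close>

definition shifted :: "int \<Rightarrow> (word \<Rightarrow> int) \<Rightarrow> word \<Rightarrow> int" where
  "shifted t F x = nbsum F x + t * F x"

lemma shifted_plus:
  "shifted t F (0 # x) + shifted t F (1 # x) = shifted (t + 1) (\<lambda>y. F (0 # y) + F (1 # y)) x"
  by (simp add: shifted_def nbsum_add algebra_simps)

lemma shifted_minus:
  "shifted t F (0 # x) - shifted t F (1 # x) = shifted (t - 1) (\<lambda>y. F (0 # y) - F (1 # y)) x"
  by (simp add: shifted_def nbsum_diff algebra_simps)

lemma sum_squares_words_Suc:
  fixes F :: "word \<Rightarrow> int"
  shows "2 * (\<Sum>x\<in>words (Suc n). (F x)\<^sup>2) =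
    (\<Sum>x\<in>words n. (F (0 # x) + F (1 # x))\<^sup>2) + (\<Sum>x\<in>words n. (F (0 # x) - F (1 # x))\<^sup>2)"
  unfolding sum_words_Suc sum.distrib[symmetric] sum_distrib_left
  by (rule sum.cong) (auto simp: power2_eq_square algebra_simps)

text \<open>
  The sums and differences of the two halves of \<open>F\<close> diagonalise the first coordinate: they are
  acted on by the operator in dimension \<open>n\<close> with shifts \<open>t + 1\<close> and \<open>t - 1\<close>. This replaces
  Fourier analysis; all eigenvalues are odd.
\<close>

lemma spectral_gap:
  assumes "odd (t + int n)"
  shows "(\<Sum>x\<in>words n. (F x)\<^sup>2) \<le> (\<Sum>x\<in>words n. (shifted t F x)\<^sup>2)"
  using assms
proof (induction n arbitrary: t F)
  case 0
  \<comment> \<open>In dimension 0 the operator is multiplication by the odd number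
    \<open>t\<close>.\<close>
  then have "t \<noteq> 0" by auto
  then have "1 \<le> t\<^sup>2" by (simp add: int_one_le_iff_zero_less)
  then show ?case using mult_right_mono[of 1 "t\<^sup>2" "(F [])\<^sup>2"]
    by (simp add: words_0 shifted_def power_mult_distrib)
next
  case (Suc n)
  have "odd (t + 1 + int n)" "odd (t - 1 + int n)" using Suc.prems by auto
  note IH = Suc.IH[OF this(1)] Suc.IH[OF this(2)]
  have "2 * (\<Sum>x\<in>words (Suc n). (F x)\<^sup>2) \<le> 2 * (\<Sum>x\<in>words (Suc n). (shifted t F x)\<^sup>2)"
    unfolding sum_squares_words_Suc shifted_plus shifted_minus by (intro add_mono IH)
  then show ?case by simp
qed

text \<open>If the norm does not grow, only the eigenvalues 1 and -1 occur in \<open>F\<close>, and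
  the square of the operator fixes it.\<close>

lemma spectral_gap_equality:
  assumes "odd (t + int n)"
    and "(\<Sum>x\<in>words n. (shifted t F x)\<^sup>2) = (\<Sum>x\<in>words n. (F x)\<^sup>2)"
    and "x \<in> words n"
  shows "shifted t (shifted t F) x = F x"
  using assms
proof (induction n arbitrary: t F x)
  case 0
  then show ?case by (auto simp: words_0 shifted_def power2_eq_square)
next
  case (Suc n)
  let ?S = "\<lambda>y. F (0 # y) + F (1 # y)" and ?D = "\<lambda>y. F (0 # y) - F (1 # y)"
  have odd: "odd (t + 1 + int n)" "odd (t - 1 + int n)" using Suc.prems by auto
  have "(\<Sum>x\<in>words n. (shifted (t + 1) ?S x)\<^sup>2) + (\<Sum>x\<in>words n. (shifted (t - 1) ?D x)\<^sup>2) =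
    (\<Sum>x\<in>words n. (?S x)\<^sup>2) + (\<Sum>x\<in>words n. (?D x)\<^sup>2)"
    using Suc.prems(2) unfolding shifted_plus[symmetric] shifted_minus[symmetric]
    unfolding sum_squares_words_Suc[symmetric] by simp
  \<comment> \<open>Both inequalities point the same way and their sums agree, so each is an
    equality.\<close>
  with spectral_gap[OF odd(1), of ?S] spectral_gap[OF odd(2), of ?D]
  have "(\<Sum>x\<in>words n. (shifted (t + 1) ?S x)\<^sup>2) = (\<Sum>x\<in>words n. (?S x)\<^sup>2)"
    and "(\<Sum>x\<in>words n. (shifted (t - 1) ?D x)\<^sup>2) = (\<Sum>x\<in>words n. (?D x)\<^sup>2)"
    by linarith+
  note IH = Suc.IH[OF odd(1) this(1)] Suc.IH[OF odd(2) this(2)]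
  obtain a y where x: "x = a # y" and y: "y \<in> words n"
    using Suc.prems(3) by (auto simp: words_Suc)
  have "shifted t (shifted t F) (0 # y) + shifted t (shifted t F) (1 # y) = F (0 # y) + F (1 # y)"
    unfolding shifted_plus by (rule IH(1)[OF y])
  moreover
  have "shifted t (shifted t F) (0 # y) - shifted t (shifted t F) (1 # y) = F (0 # y) - F (1 # y)"
    unfolding shifted_minus by (rule IH(2)[OF y])
  ultimately show ?case unfolding x by (cases a) auto
qed

section \<open>Excess of a nearly perfect covering code\<close>

text \<open>The ball sum of \<open>ind C\<close> counts the codewords covering a word, so
  \<open>E\<close> consists of the words covered twice, all others being covered once. The last
  conclusion makes this relation symmetric in \<open>C\<close> and \<open>E\<close>.\<close>

lemma np1cc_partner:
  assumes "r \<ge> 1" and "np1cc r C"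
  obtains E where "E \<subseteq> words (2 ^ r)"
    and "\<And>x. x \<in> words (2 ^ r) \<Longrightarrow> shifted 1 (ind C) x = 1 + ind E x"
    and "\<And>x. x \<in> words (2 ^ r) \<Longrightarrow> shifted 1 (ind E) x = 1 + ind C x"
proof -
  define n :: nat where "n = 2 ^ r"
  have "even n" and "n > 0" using assms(1) by (auto simp: n_def)
  have C: "C \<subseteq> words n" and card: "card C = 2 ^ (n - r)"
    and cov: "\<And>x. x \<in> words n \<Longrightarrow> \<exists>c\<in>C. hamming_dist x c \<le> 1"
    using assms(2) by (auto simp: np1cc_def n_def)
  have "r \<le> n" by (simp add: n_def less_imp_le)
  then have "n * card C = 2 ^ n"
    by (simp add: card n_def flip: power_add)
  then have "int n * int (card C) = 2 ^ n" by (metis of_nat_mult of_nat_numeral of_nat_power)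
  moreover define N where "N = int (card C)"
  ultimately have nN: "int (card (words n)) = int n * N"
    by (simp add: card_words)
  have sumC: "(\<Sum>x\<in>words n. ind C x) = N"
    using sum_ind[OF C, of "\<lambda>_. True"] by (simp add: N_def)

  define g where "g x = shifted 1 (ind C) x - 1" for x
  have Af: "shifted 1 (ind C) x = 1 + g x" for x by (simp add: g_def)
  have g_ge: "g x \<ge> 0" if x: "x \<in> words n" for x
  proof (cases "x \<in> C")
    case True
    then show ?thesis by (simp add: g_def shifted_def nbsum_nonneg)
  next
    case False
    obtain c where c: "c \<in> C" "hamming_dist x c \<le> 1" using cov[OF x] by auto
    then have "hamming_dist x c \<noteq> 0"
      using False x C hamming_dist_eq_0_iff[of x c] by (auto simp: mem_words)
    with c have "c \<in> {c \<in> C. hamming_dist x c = 1}" by auto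
    moreover have "finite {c \<in> C. hamming_dist x c = 1}"
      using finite_subset[OF C finite_words] by simp
    ultimately have "card {c \<in> C. hamming_dist x c = 1} > 0" by (auto simp: card_gt_0_iff)
    then show ?thesis using x C False by (simp add: g_def shifted_def nbsum_ind mem_words)
  qed
  \<comment> \<open>Each of the \<open>N\<close> codewords covers \<open>n + 1\<close> words, and
    there are \<open>n * N\<close> words; the surplus is \<open>N\<close>.\<close>
  have sumg: "(\<Sum>x\<in>words n. g x) = N"
    by (simp add: g_def shifted_def sum_subtractf sum.distrib sum_nbsum sumC nN algebra_simps)

  have Ag_ge: "shifted 1 g x \<ge> 1 - ind C x" if x: "x \<in> words n" for x
  proof -
    \<comment> \<open>Modulo 2 the double neighbour sum is \<open>n * ind C x\<close>, which is
      even, so only \<open>ind C x - 1\<close> survives.\<close>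
    have "shifted 1 g x = nbsum (nbsum (ind C)) x + 2 * nbsum (ind C) x + ind C x - int n - 1"
      using x unfolding g_def
      by (simp add: shifted_def[abs_def] nbsum_diff nbsum_add nbsum_const mem_words)
    moreover have "even (nbsum (nbsum (ind C)) x - int n * ind C x)"
      using even_nbsum_nbsum[of "ind C" x] x by (simp add: mem_words)
    ultimately have "odd (shifted 1 g x + ind C x)"
      using \<open>even n\<close> by auto
    moreover have "shifted 1 g x \<ge> 0"
    proof -
      \<comment> \<open>\<open>nbsum_nonneg\<close> asks for all words, while \<open>g_ge\<close>
        speaks of length \<open>n\<close> only; hence the truncation.\<close>
      have "nbsum g x = nbsum (\<lambda>y. if length y = n then g y else 0) x"
        by (rule nbsum_cong) (use x in \<open>auto simp: mem_words\<close>)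
      also have "\<dots> \<ge> 0"
        by (rule nbsum_nonneg) (use g_ge in \<open>auto simp: mem_words\<close>)
      finally show ?thesis using g_ge[OF x] by (simp add: shifted_def)
    qed
    ultimately show ?thesis by (cases "x \<in> C") (auto elim: oddE)
  qed
  have sumAg: "(\<Sum>x\<in>words n. shifted 1 g x) = (int n + 1) * N"
    by (simp add: shifted_def sum.distrib sum_nbsum sumg algebra_simps)
  have sumfAg: "(\<Sum>x\<in>words n. ind C x * shifted 1 g x) = N + (\<Sum>x\<in>words n. (g x)\<^sup>2)"
  proof -
    have "(\<Sum>x\<in>words n. ind C x * shifted 1 g x) = (\<Sum>x\<in>words n. shifted 1 (ind C) x * g x)"
      unfolding shifted_def using nbsum_symmetric[of "ind C" g n]
      by (simp add: distrib_left distrib_right sum.distrib)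
    also have "\<dots> = N + (\<Sum>x\<in>words n. (g x)\<^sup>2)"
      unfolding Af by (simp add: distrib_right sum.distrib sumg power2_eq_square)
    finally show ?thesis .
  qed
  \<comment> \<open>Only words outside \<open>C\<close> contribute. The left side is
    \<open>(n - 1) * N\<close>, the right side \<open>n * N\<close> minus the sum of
    squares.\<close>
  have "(\<Sum>x\<in>words n. 1 - ind C x) \<le> (\<Sum>x\<in>words n. shifted 1 g x - ind C x * shifted 1 g x)"
    by (rule sum_mono) (use Ag_ge in \<open>force split: if_splits simp: of_bool_def\<close>)
  then have "(\<Sum>x\<in>words n. (g x)\<^sup>2) \<le> N"
    by (simp add: sum_subtractf nN sumC sumAg sumfAg algebra_simps)
  moreover have g_sq: "g x \<le> (g x)\<^sup>2" for x
    using self_le_power[of "g x" 2] by (cases "g x \<ge> 1") (auto intro: order_trans[of _ 0])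
  then have "(\<Sum>x\<in>words n. (g x)\<^sup>2) \<ge> N"
    unfolding sumg[symmetric] by (intro sum_mono)
  ultimately have sumg2: "(\<Sum>x\<in>words n. (g x)\<^sup>2) = N" by simp
  then have "(\<Sum>x\<in>words n. (g x)\<^sup>2 - g x) = 0"
    by (simp add: sum_subtractf sumg)
  then have "(g x)\<^sup>2 - g x = 0" if "x \<in> words n" for x
    using that g_sq by (subst (asm) sum_nonneg_eq_0_iff) (auto simp: finite_words)
  then have g01: "g x = 0 \<or> g x = 1" if "x \<in> words n" for x
    using that by (simp add: power2_eq_square)

  \<comment> \<open>As \<open>ind C\<close> has mean \<open>1 / n\<close>, this is \<open>n\<close>
    times its deviation from the mean. It removes the constant component, which the operator would
    stretch by \<open>n + 1\<close>.\<close>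
  define F where "F x = int n * ind C x - 1" for x
  have AF: "shifted 1 F x = int n * g x - 1" if "x \<in> words n" for x
  proof -
    have "shifted 1 F x = int n * shifted 1 (ind C) x - (int n + 1)"
      using that unfolding F_def
      by (simp add: shifted_def nbsum_diff nbsum_scale nbsum_const mem_words algebra_simps)
    then show ?thesis by (simp add: Af algebra_simps)
  qed
  \<comment> \<open>The norm depends on \<open>h\<close> only through its sum and its sum of
    squares, and these agree for \<open>ind C\<close> and \<open>g\<close>.\<close>
  have sq: "(\<Sum>x\<in>words n. (int n * h x - 1)\<^sup>2) =
      (int n)\<^sup>2 * (\<Sum>x\<in>words n. (h x)\<^sup>2) - 2 * int n * (\<Sum>x\<in>words n. h x) + int n * N" for h
    by (simp add: power2_diff power_mult_distrib sum.distrib sum_subtractf nN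
        flip: sum_distrib_left mult.assoc)
  have "(\<Sum>x\<in>words n. (shifted 1 F x)\<^sup>2) = (\<Sum>x\<in>words n. (int n * g x - 1)\<^sup>2)"
    by (rule sum.cong) (auto simp: AF)
  also have "\<dots> = (\<Sum>x\<in>words n. (F x)\<^sup>2)"
  proof -
    have "(ind C x)\<^sup>2 = ind C x" for x by simp
    then show ?thesis unfolding F_def sq by (simp only: sumg sumg2 sumC)
  qed
  finally have AAF: "shifted 1 (shifted 1 F) x = F x" if "x \<in> words n" for x
    using that \<open>even n\<close> by (intro spectral_gap_equality[of 1 n]) auto
  have Ag: "shifted 1 g x = 1 + ind C x" if x: "x \<in> words n" for x
  proof -
    have "nbsum (shifted 1 F) x = nbsum (\<lambda>y. int n * g y - 1) x"
      by (rule nbsum_cong) (use x in \<open>auto simp: mem_words AF\<close>)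
    then have "shifted 1 (shifted 1 F) x = int n * shifted 1 g x - (int n + 1)"
      using x AF[OF x] unfolding shifted_def[of 1 "shifted 1 F"] shifted_def[of 1 g]
      by (simp add: nbsum_diff nbsum_scale nbsum_const mem_words algebra_simps)
    then have "int n * shifted 1 g x = int n * (1 + ind C x)"
      using AAF[OF x] by (simp add: F_def algebra_simps)
    then show ?thesis using \<open>n > 0\<close> by simp
  qed

  define E where "E = {x \<in> words n. g x = 1}"
  have gE: "g x = ind E x" if "x \<in> words n" for x
    using g01[OF that] that by (auto simp: E_def)
  have "shifted 1 (ind E) x = shifted 1 g x" if x: "x \<in> words n" for x
  proof -
    have "nbsum (ind E) x = nbsum g x"
      by (rule nbsum_cong) (use x in \<open>auto simp: mem_words gE\<close>)
    then show ?thesis using gE[OF x] by (simp add: shifted_def)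
  qed
  then show ?thesis
    using that[of E] by (auto simp: n_def[symmetric] Ag Af gE) (auto simp: E_def)
qed

section \<open>Diamond codes and their weight distribution\<close>

lemma diamond_code_nbsum:
  assumes "diamond_code m D" and x: "x \<in> words m"
  shows "nbsum (ind D) x = 1 + ind D x"
proof -
  have "D \<subseteq> words (length x)"
    using assms by (auto simp: diamond_code_def mem_words)
  then show ?thesis
    using assms by (auto simp: nbsum_ind diamond_code_def)
qed

text \<open>The equation itself excludes the trivial codes: the empty one would give
  \<open>0 = 1\<close>, the full one \<open>m = 2\<close>.\<close>

lemma diamond_codeI:
  assumes D: "D \<subseteq> words m" and "m > 2"
    and nb: "\<And>x. x \<in> words m \<Longrightarrow> nbsum (ind D) x = 1 + ind D x"
  shows "diamond_code m D"
proof -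
  have card: "int (card {c \<in> D. hamming_dist x c = 1}) = 1 + ind D x" if "x \<in> words m" for x
    using nb[OF that] nbsum_ind[of D x] D that by (simp add: mem_words)
  have zero: "replicate m 0 \<in> words m" by (simp add: mem_words)
  have "D \<noteq> {}"
    using nb[OF zero] nbsum_const[of 0] by auto
  moreover have "words m - D \<noteq> {}"
  proof
    assume "words m - D = {}"
    then have "nbsum (ind D) (replicate m 0) = nbsum (\<lambda>_. 1) (replicate m 0)"
      by (intro nbsum_cong) (auto simp: mem_words)
    moreover have "nbsum (ind D) (replicate m 0) \<le> 2" using nb[OF zero] by simp
    ultimately show False using \<open>m > 2\<close> by (simp add: nbsum_const)
  qed
  moreover have "card {c \<in> D. hamming_dist x c = 1} = 2" if "x \<in> D" for x
    using card[of x] that D by auto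
  moreover have "card {c \<in> D. hamming_dist x c = 1} = 1" if "x \<in> words m - D" for x
    using card[of x] that D by auto
  ultimately show ?thesis unfolding diamond_code_def using D by blast
qed

text \<open>Flipping a one lowers the weight, flipping a zero raises it. At weight 0 the truncated
  subtraction is harmless, its coefficient being 0.\<close>

lemma nbsum_weight:
  "nbsum (\<lambda>y. \<phi> (hamming_weight y)) x =
    int (hamming_weight x) * \<phi> (hamming_weight x - 1) +
    (int (length x) - int (hamming_weight x)) * \<phi> (Suc (hamming_weight x))"
proof (induction x arbitrary: \<phi>)
  case Nil
  then show ?case by (simp add: hamming_weight_Nil)
next
  case (Cons a x)
  show ?case
  proof (cases a rule: bit_cases)
    case 1
    then show ?thesis using Cons[of \<phi>]
      by (simp add: hamming_weight_Cons algebra_simps)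
  next
    case 2
    then show ?thesis using Cons[of "\<lambda>k. \<phi> (Suc k)"]
      by (cases "hamming_weight x") (simp_all add: hamming_weight_Cons algebra_simps)
  qed
qed

text \<open>The linear extension of the weight distribution from indicators to integer functions,
  which admits differences of codes and neighbour sums.\<close>

definition weight_sum :: "nat \<Rightarrow> (word \<Rightarrow> int) \<Rightarrow> nat \<Rightarrow> int" where
  "weight_sum m F i = (\<Sum>x\<in>words m. of_bool (hamming_weight x = i) * F x)"

lemma weight_sum_ind:
  "C \<subseteq> words m \<Longrightarrow> weight_sum m (ind C) i = int (weight_distribution C i)"
  by (simp only: weight_sum_def weight_distribution_def sum_ind)

lemma weight_sum_diff:
  "weight_sum m (\<lambda>x. F x - G x) i = weight_sum m F i - weight_sum m G i"
  by (simp add: weight_sum_def right_diff_distrib sum_subtractf)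

lemma weight_sum_cong:
  "(\<And>x. x \<in> words m \<Longrightarrow> F x = G x) \<Longrightarrow> weight_sum m F i = weight_sum m G i"
  unfolding weight_sum_def by (rule sum.cong) auto

lemma weight_sum_0: "weight_sum m F 0 = F (replicate m 0)"
proof -
  have "weight_sum m F 0 = (\<Sum>x\<in>words m. if x = replicate m 0 then F x else 0)"
    unfolding weight_sum_def
    by (rule sum.cong) (auto simp: mem_words hamming_weight_eq_0_iff)
  then show ?thesis by (simp add: sum.delta[OF finite_words] mem_words)
qed

lemma weight_sum_nbsum_0: "weight_sum m (nbsum F) 0 = weight_sum m F 1"
proof -
  have "weight_sum m (nbsum F) 0 =
      (\<Sum>x\<in>words m. nbsum (\<lambda>y. of_bool (hamming_weight y = 0)) x * F x)"
    unfolding weight_sum_def by (rule nbsum_symmetric)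
  also have "\<dots> = weight_sum m F 1"
    unfolding weight_sum_def
  proof (rule sum.cong[OF refl])
    show "nbsum (\<lambda>y. of_bool (hamming_weight y = 0)) x * F x = of_bool (hamming_weight x = 1) * F x"
      for x using nbsum_weight[of "\<lambda>k. of_bool (k = 0)" x]
      by (cases "hamming_weight x") auto
  qed
  finally show ?thesis .
qed

text \<open>By self-adjointness it suffices to count neighbours of weight \<open>i + 1\<close>: a
  word of weight \<open>i + 2\<close> has \<open>i + 2\<close> of them, one of weight
  \<open>i\<close> has \<open>m - i\<close>, and any other has none.\<close>

lemma weight_sum_nbsum_Suc:
  "weight_sum m (nbsum F) (Suc i) =
    int (i + 2) * weight_sum m F (i + 2) + (int m - int i) * weight_sum m F i"
proof -
  have "weight_sum m (nbsum F) (Suc i) =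
      (\<Sum>x\<in>words m. nbsum (\<lambda>y. of_bool (hamming_weight y = Suc i)) x * F x)"
    unfolding weight_sum_def by (rule nbsum_symmetric)
  also have "\<dots> = (\<Sum>x\<in>words m. int (i + 2) * (of_bool (hamming_weight x = i + 2) * F x) +
      (int m - int i) * (of_bool (hamming_weight x = i) * F x))"
  proof (rule sum.cong[OF refl])
    fix x assume "x \<in> words m"
    then show "nbsum (\<lambda>y. of_bool (hamming_weight y = Suc i)) x * F x =
        int (i + 2) * (of_bool (hamming_weight x = i + 2) * F x) +
        (int m - int i) * (of_bool (hamming_weight x = i) * F x)"
      using nbsum_weight[of "\<lambda>k. of_bool (k = Suc i)" x]
      by (cases "hamming_weight x") (auto simp: mem_words)
  qed
  finally show ?thesis
    by (simp only: weight_sum_def sum.distrib sum_distrib_left)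
qed

lemma diamond_weight_distribution_eq:
  assumes C: "diamond_code m C" and D: "diamond_code m D"
    and zeroed: "zeroed m C \<longleftrightarrow> zeroed m D"
  shows "weight_distribution C = weight_distribution D"
proof
  fix i
  have sub: "C \<subseteq> words m" "D \<subseteq> words m" using C D by (auto simp: diamond_code_def)
  \<comment> \<open>The constant 1 cancels in the difference, leaving a homogeneous recurrence with
    initial value 0.\<close>
  define u where "u x = ind C x - ind D x" for x
  have nb: "weight_sum m (nbsum u) j = weight_sum m u j" for j
  proof (rule weight_sum_cong)
    show "nbsum u x = u x" if "x \<in> words m" for x
      using diamond_code_nbsum[OF C that] diamond_code_nbsum[OF D that]
      unfolding u_def by (simp add: nbsum_diff)
  qed
  have "weight_sum m u i = 0"
  proof (induction i rule: less_induct)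
    case (less i)
    have 0: "weight_sum m u 0 = 0"
      using zeroed by (simp add: weight_sum_0 u_def zeroed_def)
    consider "i = 0" | "i = 1" | j where "i = j + 2"
      by (metis One_nat_def add_2_eq_Suc' not0_implies_Suc)
    then show ?case
    proof cases
      case 1
      then show ?thesis using 0 by simp
    next
      case 2
      then show ?thesis using 0 weight_sum_nbsum_0[of m u] nb[of 0] by simp
    next
      case (3 j)
      then have "weight_sum m u j = 0" "weight_sum m u (Suc j) = 0" using less by auto
      then show ?thesis using weight_sum_nbsum_Suc[of m u j] nb[of "Suc j"] 3 by simp
    qed
  qed
  then show "weight_distribution C i = weight_distribution D i"
    unfolding u_def weight_sum_diff by (simp add: weight_sum_ind sub)
qed

text \<open>The recurrence evaluated at weights 0 and 1, with \<open>?B\<close> counting all words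
  of a given weight.\<close>

lemma diamond_weight_distribution_small:
  assumes D: "diamond_code m D"
  shows "weight_distribution D 0 = of_bool (zeroed m D)"
    and "weight_distribution D 1 = 1 + of_bool (zeroed m D)"
    and "\<not> zeroed m D \<Longrightarrow> 2 * weight_distribution D 2 = m + 1"
proof -
  have sub: "D \<subseteq> words m" using D by (auto simp: diamond_code_def)
  let ?W = "weight_sum m (ind D)" and ?B = "weight_sum m (\<lambda>_. 1)"
  have add: "weight_sum m (nbsum (ind D)) i = ?B i + ?W i" for i
  proof -
    have "weight_sum m (nbsum (ind D)) i = weight_sum m (\<lambda>x. 1 + ind D x) i"
      by (rule weight_sum_cong) (rule diamond_code_nbsum[OF D])
    then show ?thesis unfolding weight_sum_def by (simp only: distrib_left sum.distrib)
  qed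
  have B0: "?B 0 = 1" by (simp add: weight_sum_0)
  have "?B 1 = weight_sum m (nbsum (\<lambda>_. 1)) 0" by (rule weight_sum_nbsum_0[symmetric])
  also have "\<dots> = int m" by (simp add: weight_sum_0 nbsum_const)
  finally have B1: "?B 1 = int m" .
  have W0: "?W 0 = of_bool (zeroed m D)" by (simp add: weight_sum_0 zeroed_def)
  have W1: "?W 1 = 1 + of_bool (zeroed m D)"
    using weight_sum_nbsum_0[of m "ind D"] add[of 0] by (simp add: B0 W0)
  show "weight_distribution D 0 = of_bool (zeroed m D)"
    using W0 unfolding weight_sum_ind[OF sub] by (cases "zeroed m D") simp_all
  show "weight_distribution D 1 = 1 + of_bool (zeroed m D)"
    using W1 unfolding weight_sum_ind[OF sub] by (cases "zeroed m D") simp_all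
  show "2 * weight_distribution D 2 = m + 1" if "\<not> zeroed m D"
  proof -
    have "2 * ?W 2 = int m + 1"
      using weight_sum_nbsum_Suc[of m "ind D" 0] add[of 1] that
      by (simp add: B1 W0 W1 flip: One_nat_def)
    then show ?thesis unfolding weight_sum_ind[OF sub] by linarith
  qed
qed

section \<open>Extended codes\<close>

definition extend :: "bit \<Rightarrow> word set \<Rightarrow> word set" where
  "extend p C = (\<lambda>c. c @ [parity c + p]) ` C"

lemma mem_extend: "x @ [b] \<in> extend p C \<longleftrightarrow> x \<in> C \<and> b = parity x + p"
  by (auto simp: extend_def)

lemma parity_extend: "x \<in> extend p C \<Longrightarrow> parity x = p"
  by (auto simp: extend_def parity_append simp flip: add.assoc)

lemma extend_subset: "C \<subseteq> words n \<Longrightarrow> extend p C \<subseteq> words (n + 1)"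
  by (auto simp: extend_def mem_words)

text \<open>The parity of \<open>z = x @ [b]\<close> decides whether membership of \<open>z\<close>
  tests \<open>x\<close> against \<open>C\<close> or against \<open>E\<close>. All neighbours of
  \<open>z\<close> use the other test, so their sum is a ball sum at \<open>x\<close> of the other
  set.\<close>

lemma diamond_join:
  assumes "n \<ge> 2" and sub: "C \<subseteq> words n" "E \<subseteq> words n"
    and CE: "\<And>x. x \<in> words n \<Longrightarrow> shifted 1 (ind C) x = 1 + ind E x"
    and EC: "\<And>x. x \<in> words n \<Longrightarrow> shifted 1 (ind E) x = 1 + ind C x"
  shows "diamond_code (n + 1) (extend p C \<union> extend (1 + p) E)"
proof -
  define D where "D = extend p C \<union> extend (1 + p) E"
  have mem: "y @ [c] \<in> D \<longleftrightarrow> (if c = parity y + p then y \<in> C else y \<in> E)" for y c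
    unfolding D_def by (cases c; cases p; cases "parity y") (auto simp: mem_extend)
  have "diamond_code (n + 1) D"
  proof (rule diamond_codeI)
    show "D \<subseteq> words (n + 1)" unfolding D_def using extend_subset sub by blast
    show "n + 1 > 2" using assms(1) by simp
    fix z assume "z \<in> words (n + 1)"
    then obtain x b where z: "z = x @ [b]" and x: "x \<in> words n"
      by (cases z rule: rev_cases) (auto simp: mem_words)
    show "nbsum (ind D) z = 1 + ind D z"
    proof (cases "b = parity x + p")
      case True
      then have "nbsum (\<lambda>y. ind D (y @ [b])) x = nbsum (ind E) x"
        by (intro nbsum_cong_parity) (auto simp: mem)
      moreover have "x @ [1 + b] \<in> D \<longleftrightarrow> x \<in> E" "x @ [b] \<in> D \<longleftrightarrow> x \<in> C"
        using True by (auto simp: mem)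
      ultimately show ?thesis unfolding z nbsum_append
        using EC[OF x] by (simp add: shifted_def)
    next
      case False
      then have b: "b = 1 + parity x + p"
        by (cases b; cases p; cases "parity x") auto
      then have "nbsum (\<lambda>y. ind D (y @ [b])) x = nbsum (ind C) x"
        by (intro nbsum_cong_parity) (auto simp: mem)
      moreover have "x @ [1 + b] \<in> D \<longleftrightarrow> x \<in> C" "x @ [b] \<in> D \<longleftrightarrow> x \<in> E"
        using b by (auto simp: mem simp flip: add.assoc)
      ultimately show ?thesis unfolding z nbsum_append
        using CE[OF x] by (simp add: shifted_def)
    qed
  qed
  then show ?thesis by (simp add: D_def)
qed

text \<open>The two parts of the union have opposite weight parity. The test
  \<open>of_nat i = p\<close> takes place in \<open>bit\<close>, so it compares \<open>i\<close>
  modulo 2 with \<open>p\<close>.\<close>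

lemma weight_distribution_extend:
  "weight_distribution (extend p C) i =
    (if of_nat i = p then weight_distribution (extend p C \<union> extend (1 + p) E) i else 0)"
proof -
  have "{c \<in> extend p C. hamming_weight c = i} =
    (if of_nat i = p then {c \<in> extend p C \<union> extend (1 + p) E. hamming_weight c = i} else {})"
    using parity_extend[of _ p C] parity_extend[of _ "1 + p" E] by (cases p) (auto simp: parity_eq_weight)
  then show ?thesis by (simp add: weight_distribution_def)
qed

lemma enp1cc_iff: "enp1cc r E \<longleftrightarrow> (\<exists>C p. np1cc r C \<and> E = extend p C)"
proof -
  have "{c @ [parity c] | c. c \<in> C} = extend 0 C" "{c @ [1 + parity c] | c. c \<in> C} = extend 1 C" for C
    by (auto simp: extend_def add.commute)
  moreover have "(\<exists>p. E = extend p C) \<longleftrightarrow> E = extend 0 C \<or> E = extend 1 C" for C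
    by (metis bit.exhaust)
  ultimately show ?thesis by (auto simp: enp1cc_def)
qed

definition bit_part :: "bit \<Rightarrow> (nat \<Rightarrow> nat) \<Rightarrow> nat \<Rightarrow> nat" where
  "bit_part p W i = (if of_nat i = p then W i else 0)"

lemma zero_mem_extend: "replicate (n + 1) 0 \<in> extend p C \<longleftrightarrow> replicate n 0 \<in> C \<and> p = 0"
proof -
  have "parity (replicate n 0) = 0" by (induction n) (auto simp: parity_Nil parity_Cons)
  then show ?thesis
    using mem_extend[of "replicate n 0" 0 p C] by (auto simp: replicate_append_same)
qed

text \<open>The zero word has even weight, so for \<open>p = 0\<close> it can only come from the
  part \<open>extend p C\<close>. For \<open>p = 1\<close> it would come from the partner, which is
  why the odd case later splits in two.\<close>

lemma np1cc_diamond: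
  assumes "r \<ge> 1" and C: "np1cc r C"
  obtains D where "diamond_code (2 ^ r + 1) D"
    and "weight_distribution (extend p C) = bit_part p (weight_distribution D)"
    and "p = 0 \<Longrightarrow> zeroed (2 ^ r + 1) D \<longleftrightarrow> zeroed (2 ^ r + 1) (extend p C)"
proof -
  have n: "(2::nat) ^ r \<ge> 2" using assms(1) by (simp add: self_le_power)
  obtain E where E: "E \<subseteq> words (2 ^ r)"
    "\<And>x. x \<in> words (2 ^ r) \<Longrightarrow> shifted 1 (ind C) x = 1 + ind E x"
    "\<And>x. x \<in> words (2 ^ r) \<Longrightarrow> shifted 1 (ind E) x = 1 + ind C x"
    by (rule np1cc_partner[OF assms]) blast
  have sub: "C \<subseteq> words (2 ^ r)" using C by (simp add: np1cc_def)
  show ?thesis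
  proof (rule that)
    show "diamond_code (2 ^ r + 1) (extend p C \<union> extend (1 + p) E)"
      by (rule diamond_join[OF n sub E])
    show "weight_distribution (extend p C) =
        bit_part p (weight_distribution (extend p C \<union> extend (1 + p) E))"
      by (rule ext) (simp add: bit_part_def weight_distribution_extend[of p C _ E])
    show "zeroed (2 ^ r + 1) (extend p C \<union> extend (1 + p) E) \<longleftrightarrow>
        zeroed (2 ^ r + 1) (extend p C)" if "p = 0"
      using zero_mem_extend[of "2 ^ r" "1 + p" E] that by (simp add: zeroed_def)
  qed
qed

section \<open>Syndrome codes\<close>

unbundle bit_operations_syntax

text \<open>
  The syndrome is the exclusive or of the positions of the ones, counted from \<open>k\<close>. For \<open>k = 0\<close>
  the first position does not contribute, so a syndrome code of length \<open>2 ^ r\<close> is a free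
  coordinate followed by a coset of the Hamming code.
\<close>

primrec syndrome :: "nat \<Rightarrow> word \<Rightarrow> nat" where
  "syndrome k [] = 0"
| "syndrome k (a # x) = (if a = 1 then k XOR syndrome (Suc k) x else syndrome (Suc k) x)"

lemma xor_less_power2: "a < 2 ^ r \<Longrightarrow> b < 2 ^ r \<Longrightarrow> a XOR b < (2 ^ r :: nat)"
  by (metis take_bit_nat_eq_self_iff take_bit_xor)

lemma xor_swap: "(a :: nat) XOR b = c \<longleftrightarrow> b = a XOR c"
  by (metis xor.assoc xor.commute xor_self_eq xor.left_neutral)

lemma syndrome_less: "k + length x \<le> 2 ^ r \<Longrightarrow> syndrome k x < 2 ^ r"
proof (induction x arbitrary: k)
  case (Cons a x)
  then have "syndrome (Suc k) x < 2 ^ r" and "k < 2 ^ r" by simp_all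
  then show ?case by (simp add: xor_less_power2)
qed simp

text \<open>Flipping the bit at position \<open>i\<close> changes the syndrome by exclusive or with
  \<open>k + i\<close>.\<close>

lemma nbsum_syndrome:
  "nbsum (\<lambda>y. of_bool (syndrome k y = s)) x =
    (\<Sum>i<length x. of_bool ((k + i) XOR syndrome k x = s))"
proof (induction x arbitrary: k s)
  case (Cons a x)
  have "syndrome k ((1 + a) # x) = k XOR syndrome k (a # x)"
    by (cases a rule: bit_cases) (simp_all add: xor.assoc[of k k, symmetric])
  moreover have "nbsum (\<lambda>y. of_bool (syndrome k (a # y) = s)) x =
    (\<Sum>i<length x. of_bool ((k + Suc i) XOR syndrome k (a # x) = s))"
  proof (cases a rule: bit_cases)
    case 1
    then show ?thesis using Cons[of "Suc k" s] by simp
  next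
    case 2
    \<comment> \<open>The leading one moves the target from \<open>s\<close> to
      \<open>k XOR s\<close>, so the induction must keep \<open>s\<close> arbitrary.\<close>
    have "(k XOR syndrome (Suc k) y = s) = (syndrome (Suc k) y = k XOR s)" for y
      by (rule xor_swap)
    moreover have "((k + Suc i) XOR (k XOR syndrome (Suc k) x) = s) =
      ((Suc k + i) XOR syndrome (Suc k) x = k XOR s)" for i
      using xor_swap[of k "(k + Suc i) XOR syndrome (Suc k) x" s] by (simp add: xor.left_commute)
    ultimately show ?thesis using 2 Cons[of "Suc k" "k XOR s"] by simp
  qed
  ultimately show ?case
    by (simp only: nbsum.simps length_Cons sum.lessThan_Suc_shift add_0_right)
qed simp

lemma syndrome_zero: "syndrome k (replicate m 0) = 0"
  by (induction m arbitrary: k) auto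

definition syndrome_code :: "nat \<Rightarrow> nat \<Rightarrow> word set" where
  "syndrome_code r s = {x \<in> words (2 ^ r). syndrome 0 x = s}"

text \<open>The positions run once through all numbers below \<open>2 ^ r\<close>, so exactly one
  flip, at \<open>?t XOR s\<close>, turns the syndrome \<open>?t\<close> into
  \<open>s\<close>.\<close>

lemma nbsum_syndrome_code:
  assumes "s < 2 ^ r" and x: "x \<in> words (2 ^ r)"
  shows "nbsum (ind (syndrome_code r s)) x = 1"
proof -
  let ?t = "syndrome 0 x"
  have "?t < 2 ^ r" using x by (intro syndrome_less) (simp add: mem_words)
  then have lt: "?t XOR s < 2 ^ r" using assms(1) by (rule xor_less_power2)
  have "nbsum (ind (syndrome_code r s)) x = nbsum (\<lambda>y. of_bool (syndrome 0 y = s)) x"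
    by (rule nbsum_cong) (use x in \<open>auto simp: syndrome_code_def mem_words\<close>)
  also have "\<dots> = (\<Sum>i<2 ^ r. of_bool (i XOR ?t = s))"
    using x by (simp add: nbsum_syndrome mem_words)
  also have "\<dots> = (\<Sum>i<2 ^ r. if i = ?t XOR s then 1 else 0)"
    by (rule sum.cong) (auto simp: xor.commute[of _ ?t] xor_swap[of ?t])
  finally show ?thesis using lt by simp
qed

text \<open>Every word has exactly one neighbour in the code: this gives the covering, and double
  counting gives the size.\<close>

lemma np1cc_syndrome_code:
  assumes s: "s < 2 ^ r"
  shows "np1cc r (syndrome_code r s)"
proof -
  let ?C = "syndrome_code r s"
  have sub: "?C \<subseteq> words (2 ^ r)" by (auto simp: syndrome_code_def)
  have "r \<le> 2 ^ r" by (simp add: less_imp_le)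
  have "int (2 ^ r) * int (card ?C) = (\<Sum>x\<in>words (2 ^ r). nbsum (ind ?C) x)"
    using sum_ind[OF sub, of "\<lambda>_. True"] by (simp add: sum_nbsum)
  also have "\<dots> = (\<Sum>x\<in>words (2 ^ r). 1)"
    by (rule sum.cong) (auto simp: nbsum_syndrome_code[OF s])
  finally have "int (2 ^ r * card ?C) = int (2 ^ 2 ^ r)" by (simp add: card_words)
  then have "2 ^ r * card ?C = 2 ^ 2 ^ r" by (simp only: of_nat_eq_iff)
  also have "\<dots> = 2 ^ r * 2 ^ (2 ^ r - r)"
    using \<open>r \<le> 2 ^ r\<close> by (simp flip: power_add)
  finally have "card ?C = 2 ^ (2 ^ r - r)" by (simp only: mult_cancel1) simp
  moreover have "\<exists>c\<in>?C. hamming_dist x c \<le> 1" if x: "x \<in> words (2 ^ r)" for x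
  proof -
    have "card {c \<in> ?C. hamming_dist x c = 1} = 1"
      using nbsum_syndrome_code[OF s x] nbsum_ind[of ?C x] sub x by (simp add: mem_words)
    then obtain c where "{c \<in> ?C. hamming_dist x c = 1} = {c}" by (rule card_1_singletonE)
    then have "c \<in> {c \<in> ?C. hamming_dist x c = 1}" by blast
    then show ?thesis by (intro bexI[of _ c]) auto
  qed
  ultimately show ?thesis using sub unfolding np1cc_def by blast
qed

text \<open>A syndrome code is its own partner. Using it for both parities puts the zero word into
  the union exactly when its syndrome 0 equals \<open>s\<close>.\<close>

lemma syndrome_code_diamond:
  assumes "r \<ge> 1" and s: "s < 2 ^ r"
  obtains D where "diamond_code (2 ^ r + 1) D"
    and "weight_distribution (extend p (syndrome_code r s)) = bit_part p (weight_distribution D)"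
    and "zeroed (2 ^ r + 1) D \<longleftrightarrow> s = 0"
proof -
  let ?C = "syndrome_code r s"
  have n: "(2::nat) ^ r \<ge> 2" using assms(1) by (simp add: self_le_power)
  have sub: "?C \<subseteq> words (2 ^ r)" by (auto simp: syndrome_code_def)
  have "shifted 1 (ind ?C) x = 1 + ind ?C x" if "x \<in> words (2 ^ r)" for x
    by (simp add: shifted_def nbsum_syndrome_code[OF s that])
  then have "diamond_code (2 ^ r + 1) (extend p ?C \<union> extend (1 + p) ?C)"
    by (intro diamond_join[OF n sub sub])
  moreover have "weight_distribution (extend p ?C) =
      bit_part p (weight_distribution (extend p ?C \<union> extend (1 + p) ?C))"
    by (rule ext) (simp add: bit_part_def weight_distribution_extend[of p ?C _ ?C])
  moreover have "zeroed (2 ^ r + 1) (extend p ?C \<union> extend (1 + p) ?C) \<longleftrightarrow> s = 0"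
    unfolding zeroed_def Un_iff zero_mem_extend
    by (cases p) (auto simp: syndrome_code_def mem_words syndrome_zero)
  ultimately show ?thesis by (rule that)
qed

section \<open>Classification of the weight distributions\<close>

theorem theorem2:
  fixes r n :: nat
  assumes "r \<ge> 2" and "n = 2 ^ r"
  shows
    "(\<forall>C D. diamond_code (n + 1) C \<and> zeroed (n + 1) C \<and>
            diamond_code (n + 1) D \<and> zeroed (n + 1) D
            \<longrightarrow> weight_distribution C = weight_distribution D) \<and>
     (\<forall>C D. diamond_code (n + 1) C \<and> \<not> zeroed (n + 1) C \<and>
            diamond_code (n + 1) D \<and> \<not> zeroed (n + 1) D
            \<longrightarrow> weight_distribution C = weight_distribution D) \<and>
     (\<forall>C D. enp1cc r C \<and> zeroed (n + 1) C \<and> enp1cc r D \<and> zeroed (n + 1) D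
            \<longrightarrow> weight_distribution C = weight_distribution D) \<and>
     (\<exists>A A' A''.
        {weight_distribution C | C. enp1cc r C \<and> \<not> zeroed (n + 1) C} = {A, A', A''} \<and>
        distinct [A, A', A''] \<and>
        A 0 = 0 \<and> A 1 = 1 \<and> A 2 = 0 \<and>
        A' 0 = 0 \<and> A' 1 = 2 \<and> A' 2 = 0 \<and>
        A'' 0 = 0 \<and> A'' 1 = 0 \<and> A'' 2 = n div 2 + 1)"
proof -
  have r: "r \<ge> 1" using assms(1) by simp
  have n: "n = 2 ^ r" by (fact assms(2))
  note diamond_eq = diamond_weight_distribution_eq[where m = "n + 1"]
  have one: "1 < (2::nat) ^ r" using r by (intro one_less_power) auto
  have zero: "0 < (2::nat) ^ r" by simp

  have zeroed_eq: "weight_distribution C = weight_distribution D"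
    if C: "enp1cc r C" "zeroed (n + 1) C" and D: "enp1cc r D" "zeroed (n + 1) D" for C D
  proof -
    have *: "\<exists>K. diamond_code (n + 1) K \<and> zeroed (n + 1) K \<and>
        weight_distribution C = bit_part 0 (weight_distribution K)"
      if C: "enp1cc r C" "zeroed (n + 1) C" for C
    proof -
      obtain C' p where C': "np1cc r C'" "C = extend p C'"
        using C(1) unfolding enp1cc_iff by blast
      moreover have p: "p = 0"
        using C(2) unfolding C'(2) zeroed_def zero_mem_extend by blast
      ultimately show ?thesis
        using np1cc_diamond[OF r C'(1), of p] C(2) unfolding n by metis
    qed
    show ?thesis using *[OF C] *[OF D] diamond_eq by metis
  qed

  \<comment> \<open>The three witnesses are the odd part of a non-zeroed diamond code, the odd part
    of a zeroed one and the even part of a non-zeroed one. The remaining combination is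
    zeroed.\<close>
  obtain K where K: "diamond_code (n + 1) K" "\<not> zeroed (n + 1) K"
    "weight_distribution (extend 1 (syndrome_code r 1)) = bit_part 1 (weight_distribution K)"
    using syndrome_code_diamond[OF r one, of 1] unfolding n by (metis one_neq_zero)
  obtain K' where K': "diamond_code (n + 1) K'" "zeroed (n + 1) K'"
    "weight_distribution (extend 1 (syndrome_code r 0)) = bit_part 1 (weight_distribution K')"
    using syndrome_code_diamond[OF r zero, of 1] unfolding n by metis
  obtain K'' where K'': "diamond_code (n + 1) K''" "\<not> zeroed (n + 1) K''"
    "weight_distribution (extend 0 (syndrome_code r 1)) = bit_part 0 (weight_distribution K'')"
    using syndrome_code_diamond[OF r one, of 0] unfolding n by (metis one_neq_zero)
  let ?A = "weight_distribution (extend 1 (syndrome_code r 1))"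
  let ?A' = "weight_distribution (extend 1 (syndrome_code r 0))"
  let ?A'' = "weight_distribution (extend 0 (syndrome_code r 1))"

  have "{weight_distribution C | C. enp1cc r C \<and> \<not> zeroed (n + 1) C} = {?A, ?A', ?A''}"
  proof (intro subset_antisym subsetI)
    fix W assume "W \<in> {weight_distribution C | C. enp1cc r C \<and> \<not> zeroed (n + 1) C}"
    then obtain C p where C: "np1cc r C" "W = weight_distribution (extend p C)"
      "\<not> zeroed (n + 1) (extend p C)"
      unfolding enp1cc_iff by blast
    obtain D where D: "diamond_code (n + 1) D" "W = bit_part p (weight_distribution D)"
      "p = 0 \<Longrightarrow> \<not> zeroed (n + 1) D"
      using np1cc_diamond[OF r C(1), of p] C(2,3) unfolding n by metis
    show "W \<in> {?A, ?A', ?A''}"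
    proof (cases p rule: bit_cases)
      case 1
      then show ?thesis using D K'' diamond_eq[OF D(1) K''(1)] by simp
    next
      case 2
      then show ?thesis
        using D K K' diamond_eq[OF D(1) K(1)] diamond_eq[OF D(1) K'(1)]
        by (cases "zeroed (n + 1) D") simp_all
    qed
  next
    have "zeroed (n + 1) (extend p (syndrome_code r s)) \<longleftrightarrow> s = 0 \<and> p = 0" for p s
      unfolding zeroed_def zero_mem_extend
      by (auto simp: syndrome_code_def mem_words n syndrome_zero)
    then have "weight_distribution (extend p (syndrome_code r s)) \<in>
        {weight_distribution C | C. enp1cc r C \<and> \<not> zeroed (n + 1) C}"
      if "s < 2 ^ r" "\<not> (s = 0 \<and> p = 0)" for p s
      using np1cc_syndrome_code[OF that(1)] that(2) unfolding enp1cc_iff by blast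
    note * = this[OF one] this[OF zero]
    fix W assume "W \<in> {?A, ?A', ?A''}"
    then consider "W = ?A" | "W = ?A'" | "W = ?A''" by blast
    then show "W \<in> {weight_distribution C | C. enp1cc r C \<and> \<not> zeroed (n + 1) C}"
      by cases (simp_all only: *, (rule * , simp)+)
  qed
  moreover have A: "?A 0 = 0" "?A 1 = 1" "?A 2 = 0"
    using K(2) diamond_weight_distribution_small[OF K(1)] unfolding K(3) bit_part_def by auto
  moreover have A': "?A' 0 = 0" "?A' 1 = 2" "?A' 2 = 0"
    using K'(2) diamond_weight_distribution_small[OF K'(1)] unfolding K'(3) bit_part_def by auto
  \<comment> \<open>With \<open>m = n + 1\<close> the coefficient at weight 2 satisfies
    \<open>2 * ?A'' 2 = n + 2\<close>.\<close>
  moreover have A'': "?A'' 0 = 0" "?A'' 1 = 0" "?A'' 2 = n div 2 + 1"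
    using K''(2) diamond_weight_distribution_small[OF K''(1)] unfolding K''(3) bit_part_def by auto
  moreover have "distinct [?A, ?A', ?A'']"
  proof -
    have "?A 1 \<noteq> ?A' 1" "?A 1 \<noteq> ?A'' 1" "?A' 1 \<noteq> ?A'' 1"
      unfolding A(2) A'(2) A''(2) by simp_all
    then have "?A \<noteq> ?A'" "?A \<noteq> ?A''" "?A' \<noteq> ?A''" by metis+
    then show ?thesis by simp
  qed
  ultimately have "\<exists>A A' A''.
        {weight_distribution C | C. enp1cc r C \<and> \<not> zeroed (n + 1) C} = {A, A', A''} \<and>
        distinct [A, A', A''] \<and>
        A 0 = 0 \<and> A 1 = 1 \<and> A 2 = 0 \<and>
        A' 0 = 0 \<and> A' 1 = 2 \<and> A' 2 = 0 \<and>
        A'' 0 = 0 \<and> A'' 1 = 0 \<and> A'' 2 = n div 2 + 1"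
    by blast
  then show ?thesis using zeroed_eq diamond_eq by blast
qed

end
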